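(* Let $M$ be an $\mathfrak{L}$-module such that $M$ is free of rank one as a $U(\mathbb{C}L_{0,0})$-module. Then $M\cong\Omega(\lambda,\mu,\alpha)$ as $\mathfrak{L}$-modules for some $\lambda,\mu\in\mathbb{C}^*$ and $\alpha\in\mathbb{C}$. Moreover, $M$ is simple if and only if $M\cong\Omega(\lambda,\mu,\alpha)$ for some $\lambda,\mu,\alpha\in\mathbb{C}^*$.
   Context: All vector spaces and Lie algebras are over $\mathbb{C}$; $\mathbb{C}^*$ denotes the nonzero complex numbers, and $U(\mathfrak{g})$ the universal enveloping algebra of a Lie algebra $\mathfrak{g}$ (so $U(\mathbb{C}L_{0,0})=\mathbb{C}[L_{0,0}]$ is a polynomial algebra in one variable). The Virasoro algebra $\mathfrak{V}$ has basis $\{L_i, C\mid i\in\mathbb{Z}\}$ and relations $[L_i,L_j]=(j-i)L_{i+j}+\delta_{i+j,0}\frac{i^3-i}{12}C$, $[L_i,C]=0$. The loop-Virasoro algebra is $\mathfrak{L}=\mathfrak{V}\otimes\mathbb{C}[t^{\pm1}]$, with basis $\{L_{i,j}:=L_i\otimes t^j,\ C_j:=C\otimes t^j\mid (i,j)\in\mathbb{Z}^2\}$ and relations, for all $i,j,k,l\in\mathbb{Z}$, $$[L_{i,j},L_{k,l}]=(k-i)L_{i+k,j+l}+\delta_{i+k,0}\frac{i^3-i}{12}C_{j+l},\qquad [L_{i,j},C_l]=0,\qquad [C_j,C_l]=0.$$ For $\lambda,\mu\in\mathbb{C}^*$ and $\alpha\in\mathbb{C}$, $\Omega(\lambda,\mu,\alpha)$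 is the $\mathfrak{L}$-module with underlying space $\mathbb{C}[t]$ and action $$L_{i,j}\cdot f(t)=\lambda^{i-j}\mu^j(t-i\alpha)f(t-i),\qquad C_i\cdot f(t)=0,$$ for $f(t)\in\mathbb{C}[t]$, $(i,j)\in\mathbb{Z}^2$. *)

theory Defs
  imports
    Complex_Main
    "HOL-Computational_Algebra.Polynomial"
    "HOL-Library.Poly_Mapping"
begin

section \<open>Lie algebras and their modules\<close>

locale lie_algebra = vector_space lscale
  for lscale :: "'f::field \<Rightarrow> 'l::ab_group_add \<Rightarrow> 'l" +
  fixes bracket :: "'l \<Rightarrow> 'l \<Rightarrow> 'l"
  assumes bracket_linear_right: "Vector_Spaces.linear lscale lscale (\<lambda>y. bracket x y)"
    and bracket_linear_left: "Vector_Spaces.linear lscale lscale (\<lambda>x. bracket x y)"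
    and bracket_self: "bracket x x = 0"
    and jacobi: "bracket x (bracket y z) + bracket y (bracket z x) + bracket z (bracket x y) = 0"

locale lie_module =
  lie_algebra lscale bracket + M: vector_space mscale
  for lscale :: "'f::field \<Rightarrow> 'l::ab_group_add \<Rightarrow> 'l"
    and bracket :: "'l \<Rightarrow> 'l \<Rightarrow> 'l"
    and mscale :: "'f \<Rightarrow> 'm::ab_group_add \<Rightarrow> 'm" +
  fixes act :: "'l \<Rightarrow> 'm \<Rightarrow> 'm"
  assumes act_linear_right: "Vector_Spaces.linear mscale mscale (\<lambda>v. act x v)"
    and act_linear_left: "Vector_Spaces.linear lscale mscale (\<lambda>x. act x v)"
    and act_bracket: "act (bracket x y) v = act x (act y v) - act y (act x v)"

definition lie_submodule ::
    "('f::field \<Rightarrow> 'm::ab_group_add \<Rightarrow> 'm) \<Rightarrow> ('l \<Rightarrow> 'm \<Rightarrow> 'm) \<Rightarrow> 'm set \<Rightarrow> bool" where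
  "lie_submodule mscale act N \<longleftrightarrow>
     module.subspace mscale N \<and> (\<forall>x. \<forall>v\<in>N. act x v \<in> N)"

definition simple_lie_module ::
    "('f::field \<Rightarrow> 'm::ab_group_add \<Rightarrow> 'm) \<Rightarrow> ('l \<Rightarrow> 'm \<Rightarrow> 'm) \<Rightarrow> bool" where
  "simple_lie_module mscale act \<longleftrightarrow>
     (UNIV :: 'm set) \<noteq> {0} \<and> (\<forall>N. lie_submodule mscale act N \<longrightarrow> N = {0} \<or> N = UNIV)"

definition lie_module_iso ::
    "('f::field \<Rightarrow> 'm::ab_group_add \<Rightarrow> 'm) \<Rightarrow> ('l \<Rightarrow> 'm \<Rightarrow> 'm) \<Rightarrow>
     ('f \<Rightarrow> 'n::ab_group_add \<Rightarrow> 'n) \<Rightarrow> ('l \<Rightarrow> 'n \<Rightarrow> 'n) \<Rightarrow> bool" where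
  "lie_module_iso mscale act nscale act' \<longleftrightarrow>
     (\<exists>\<phi>. Vector_Spaces.linear mscale nscale \<phi> \<and> bij \<phi> \<and> (\<forall>x v. \<phi> (act x v) = act' x (\<phi> v)))"

section \<open>Modules over the enveloping algebra of a one-dimensional Lie algebra\<close>

text \<open>
  For a single element \<open>X\<close>, the enveloping algebra of the span of \<open>X\<close> is the polynomial
  algebra in \<open>X\<close>. If \<open>X\<close> acts by the endomorphism \<open>T\<close>, the polynomial
  \<open>p = \<Sum>i. c\<^sub>i X\<^sup>i\<close> acts by \<open>\<Sum>i. c\<^sub>i T\<^sup>i\<close>. The lemmas
  \<open>module_poly_action\<close> and \<open>poly_action_unique\<close> below say that this is the only module
  structure over the polynomial algebra that extends the vector space structure and in
  which \<open>X\<close> acts by \<open>T\<close>.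
\<close>

definition poly_action ::
    "('f::field \<Rightarrow> 'm::ab_group_add \<Rightarrow> 'm) \<Rightarrow> ('m \<Rightarrow> 'm) \<Rightarrow> 'f poly \<Rightarrow> 'm \<Rightarrow> 'm" where
  "poly_action mscale T p v = (\<Sum>i\<le>degree p. mscale (coeff p i) ((T ^^ i) v))"

definition free_of_rank_one :: "('r::comm_ring_1 \<Rightarrow> 'm::ab_group_add \<Rightarrow> 'm) \<Rightarrow> bool" where
  "free_of_rank_one rscale \<longleftrightarrow>
     (\<exists>v. \<not> module.dependent rscale {v} \<and> module.span rscale {v} = UNIV)"

context
  fixes mscale :: "'f::field \<Rightarrow> 'm::ab_group_add \<Rightarrow> 'm" and T :: "'m \<Rightarrow> 'm"
  assumes lin: "Vector_Spaces.linear mscale mscale T"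
begin

interpretation T: Vector_Spaces.linear mscale mscale T by (rule lin)

lemma poly_action_pCons:
  "poly_action mscale T (pCons c p) v = mscale c v + T (poly_action mscale T p v)"
proof -
  have s: "T ((T ^^ i) v) = (T ^^ Suc i) v" for i by simp
  show ?thesis
  proof (cases "p = 0")
    case True
    then show ?thesis by (simp add: poly_action_def T.zero)
  next
    case False
    then show ?thesis
      by (simp only: poly_action_def degree_pCons_eq[OF False] sum.atMost_Suc_shift
          T.sum T.scale s coeff_pCons_0 coeff_pCons_Suc funpow_0)
  qed
qed

lemma poly_action_0: "poly_action mscale T 0 v = 0"
  by (simp add: poly_action_def)

lemma poly_action_add_left:
  "poly_action mscale T (p + q) v = poly_action mscale T p v + poly_action mscale T q v"
  by (induction p q rule: poly_induct2)
    (simp_all add: poly_action_0 poly_action_pCons T.add T.vs1.scale_left_distrib algebra_simps)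

lemma poly_action_smult: "poly_action mscale T (smult c p) v = mscale c (poly_action mscale T p v)"
  by (induction p)
    (simp_all add: poly_action_0 poly_action_pCons T.scale T.vs1.scale_right_distrib)

lemma poly_action_mult:
  "poly_action mscale T (p * q) v = poly_action mscale T p (poly_action mscale T q v)"
  by (induction p)
    (simp_all add: poly_action_0 poly_action_pCons poly_action_add_left poly_action_smult)

lemma poly_action_add_right:
  "poly_action mscale T p (v + w) = poly_action mscale T p v + poly_action mscale T p w"
  by (induction p)
    (simp_all add: poly_action_0 poly_action_pCons T.add T.vs1.scale_right_distrib algebra_simps)

lemma poly_action_const: "poly_action mscale T [:c:] v = mscale c v"
  by (simp add: poly_action_pCons poly_action_0 T.zero)

lemma poly_action_X: "poly_action mscale T [:0, 1:] v = T v"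
  by (simp add: poly_action_pCons poly_action_0 T.zero)

lemma module_poly_action: "module (poly_action mscale T)"
  by standard
    (simp_all add: poly_action_add_left poly_action_add_right poly_action_mult
      poly_action_const one_pCons)

lemma poly_action_unique:
  assumes "module r" and "\<And>c v. r [:c:] v = mscale c v" and "\<And>v. r [:0, 1:] v = T v"
  shows "r = poly_action mscale T"
proof (intro ext)
  fix p v
  interpret R: module r by fact
  show "r p v = poly_action mscale T p v"
  proof (induction p)
    case 0
    then show ?case by (simp add: poly_action_0)
  next
    case (pCons c p)
    have "pCons c p = [:c:] + [:0, 1:] * p" by simp
    then have "r (pCons c p) v = r [:c:] v + r [:0, 1:] (r p v)"
      by (simp only: R.scale_left_distrib R.scale_scale)
    then show ?case by (simp add: pCons assms poly_action_pCons)
  qed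
qed

end

section \<open>The loop-Virasoro algebra\<close>

text \<open>
  Vectors are finitely supported complex-valued functions on the basis:
  \<open>L_gen i j\<close> stands for the basis vector \<open>L\<^sub>i \<otimes> t\<^sup>j\<close>
  and \<open>C_gen j\<close> for \<open>C \<otimes> t\<^sup>j\<close>.
\<close>

datatype lvir_basis = L_gen int int | C_gen int

type_synonym lvir = "lvir_basis \<Rightarrow>\<^sub>0 complex"

definition lvir_scale :: "complex \<Rightarrow> lvir \<Rightarrow> lvir" where
  "lvir_scale c x = Poly_Mapping.map ((*) c) x"

definition L_elem :: "int \<Rightarrow> int \<Rightarrow> lvir" where
  "L_elem i j = Poly_Mapping.single (L_gen i j) 1"

definition C_elem :: "int \<Rightarrow> lvir" where
  "C_elem j = Poly_Mapping.single (C_gen j) 1"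

text \<open>The linear extension of a map \<open>g\<close> given on the basis.\<close>

definition lin_ext ::
    "(complex \<Rightarrow> 'm::ab_group_add \<Rightarrow> 'm) \<Rightarrow> (lvir_basis \<Rightarrow> 'm) \<Rightarrow> lvir \<Rightarrow> 'm" where
  "lin_ext s g x = (\<Sum>a\<in>Poly_Mapping.keys x. s (Poly_Mapping.lookup x a) (g a))"

fun basis_bracket :: "lvir_basis \<Rightarrow> lvir_basis \<Rightarrow> lvir" where
  "basis_bracket (L_gen i j) (L_gen k l) =
     lvir_scale (of_int (k - i)) (L_elem (i + k) (j + l)) +
     (if i + k = 0 then lvir_scale (of_int (i ^ 3 - i) / 12) (C_elem (j + l)) else 0)"
| "basis_bracket (L_gen i j) (C_gen l) = 0"
| "basis_bracket (C_gen j) (L_gen k l) = 0"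
| "basis_bracket (C_gen j) (C_gen l) = 0"

definition lvir_bracket :: "lvir \<Rightarrow> lvir \<Rightarrow> lvir" where
  "lvir_bracket x y =
     lin_ext lvir_scale (\<lambda>a. lin_ext lvir_scale (\<lambda>b. basis_bracket a b) y) x"

abbreviation lvir_module ::
    "(complex \<Rightarrow> 'm::ab_group_add \<Rightarrow> 'm) \<Rightarrow> (lvir \<Rightarrow> 'm \<Rightarrow> 'm) \<Rightarrow> bool" where
  "lvir_module \<equiv> lie_module lvir_scale lvir_bracket"

section \<open>The modules \<open>\<Omega>(\<lambda>, \<mu>, \<alpha>)\<close>\<close>

text \<open>The shifted polynomial \<open>f(t - i)\<close> is the composition of \<open>f\<close> with \<open>t - i\<close>.\<close>

fun Omega_basis ::
    "complex \<Rightarrow> complex \<Rightarrow> complex \<Rightarrow> lvir_basis \<Rightarrow> complex poly \<Rightarrow> complex poly" where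
  "Omega_basis lam mu al (L_gen i j) f =
     smult (lam powi (i - j) * mu powi j)
       ([:- (of_int i * al), 1:] * pcompose f [:- of_int i, 1:])"
| "Omega_basis lam mu al (C_gen j) f = 0"

definition Omega ::
    "complex \<Rightarrow> complex \<Rightarrow> complex \<Rightarrow> lvir \<Rightarrow> complex poly \<Rightarrow> complex poly" where
  "Omega lam mu al x f = lin_ext smult (\<lambda>a. Omega_basis lam mu al a f) x"

section \<open>Well-definedness\<close>

lemma lookup_lvir_scale [simp]:
  "Poly_Mapping.lookup (lvir_scale c x) a = c * Poly_Mapping.lookup x a"
  by (simp add: lvir_scale_def Poly_Mapping.map.rep_eq when_def)

lemma vector_space_lvir: "vector_space lvir_scale"
  by standard (auto intro!: poly_mapping_eqI simp: lookup_add algebra_simps)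

interpretation lvir: vector_space lvir_scale by (rule vector_space_lvir)

lemma vector_space_smult: "vector_space (smult :: complex \<Rightarrow> _)"
  by standard (auto simp: smult_add_right smult_add_left)

lemma lin_ext_superset:
  assumes "vector_space s" "finite A" "Poly_Mapping.keys x \<subseteq> A"
  shows "lin_ext s g x = (\<Sum>a\<in>A. s (Poly_Mapping.lookup x a) (g a))"
proof -
  interpret vector_space s by fact
  show ?thesis
    unfolding lin_ext_def using assms(2,3)
    by (intro sum.mono_neutral_left) (auto simp: in_keys_iff)
qed

lemma linear_lin_ext:
  assumes "vector_space s"
  shows "Vector_Spaces.linear lvir_scale s (lin_ext s g)"
proof -
  interpret V: vector_space s by fact
  interpret vector_space_pair lvir_scale s ..
  show ?thesis
    unfolding Vector_Spaces.linear_iff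
  proof (intro conjI allI)
    show "vector_space lvir_scale" "vector_space s" by unfold_locales
  next
    fix x y :: lvir
    let ?A = "Poly_Mapping.keys x \<union> Poly_Mapping.keys y"
    have "lin_ext s g z = (\<Sum>a\<in>?A. s (Poly_Mapping.lookup z a) (g a))"
      if "z \<in> {x, y, x + y}" for z
      using that Poly_Mapping.keys_add[of x y]
      by (intro lin_ext_superset assms) auto
    then show "lin_ext s g (x + y) = lin_ext s g x + lin_ext s g y"
      by (simp add: lookup_add V.scale_left_distrib sum.distrib)
  next
    fix c and x :: lvir
    have "lin_ext s g z = (\<Sum>a\<in>Poly_Mapping.keys x. s (Poly_Mapping.lookup z a) (g a))"
      if "z \<in> {x, lvir_scale c x}" for z
      using that by (intro lin_ext_superset assms) (auto simp: in_keys_iff)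
    then show "lin_ext s g (lvir_scale c x) = s c (lin_ext s g x)"
      by (simp add: V.scale_sum_right)
  qed
qed

lemma lin_ext_single:
  assumes "vector_space s"
  shows "lin_ext s g (Poly_Mapping.single a 1) = g a"
proof -
  interpret V: vector_space s by fact
  show ?thesis by (simp add: lin_ext_def)
qed

lemma linear_lin_ext_param:
  assumes "vector_space s" "vector_space s'"
    and g: "\<And>a. Vector_Spaces.linear s' s (\<lambda>v. g v a)"
  shows "Vector_Spaces.linear s' s (\<lambda>v. lin_ext s (g v) x)"
proof -
  interpret V: vector_space s by fact
  interpret W: vector_space s' by fact
  interpret vector_space_pair s' s ..
  show ?thesis
    unfolding lin_ext_def
    by (intro linear_compose_sum ballI linear_compose_scale_right g)
qed

lemma lvir_expand:
  "x = (\<Sum>a\<in>Poly_Mapping.keys x. lvir_scale (Poly_Mapping.lookup x a) (Poly_Mapping.single a 1))"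
proof -
  have "(\<Sum>a\<in>Poly_Mapping.keys x. Poly_Mapping.lookup x a * (1 when a = b)) =
      Poly_Mapping.lookup x b" for b
    by (simp add: when_def if_distrib in_keys_iff cong: if_cong)
  then show ?thesis
    by (intro poly_mapping_eqI) (simp add: lookup_sum lookup_single)
qed

text \<open>Linear maps that agree on the basis are equal.\<close>

lemma lvir_linear_eqI:
  assumes "Vector_Spaces.linear lvir_scale s f" "Vector_Spaces.linear lvir_scale s g"
    and "\<And>a. f (Poly_Mapping.single a 1) = g (Poly_Mapping.single a 1)"
  shows "f x = g x"
proof -
  interpret f: Vector_Spaces.linear lvir_scale s f by fact
  interpret g: Vector_Spaces.linear lvir_scale s g by fact
  show ?thesis
    by (subst (1 2) lvir_expand) (simp add: f.sum g.sum f.scale g.scale assms(3))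
qed

lemma lvir_bracket_linear_left:
  "Vector_Spaces.linear lvir_scale lvir_scale (\<lambda>x. lvir_bracket x y)"
  unfolding lvir_bracket_def by (rule linear_lin_ext[OF vector_space_lvir])

lemma lvir_bracket_linear_right:
  "Vector_Spaces.linear lvir_scale lvir_scale (\<lambda>y. lvir_bracket x y)"
  unfolding lvir_bracket_def
  by (intro linear_lin_ext_param linear_lin_ext vector_space_lvir)

lemma lvir_bracket_single:
  "lvir_bracket (Poly_Mapping.single a 1) (Poly_Mapping.single b 1) = basis_bracket a b"
  by (simp add: lvir_bracket_def lin_ext_single vector_space_lvir)

interpretation lvir_pair: vector_space_pair lvir_scale lvir_scale ..

lemma lvir_bracket_L_L:
  "lvir_bracket (L_elem i j) (L_elem k l) =
     lvir_scale (of_int (k - i)) (L_elem (i + k) (j + l)) +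
     (if i + k = 0 then lvir_scale (of_int (i ^ 3 - i) / 12) (C_elem (j + l)) else 0)"
  by (simp add: L_elem_def[of i j] L_elem_def[of k l] lvir_bracket_single)

lemma lvir_bracket_L_C: "lvir_bracket (L_elem i j) (C_elem l) = 0"
  and lvir_bracket_C_L: "lvir_bracket (C_elem l) (L_elem i j) = 0"
  and lvir_bracket_C_C: "lvir_bracket (C_elem j) (C_elem l) = 0"
  by (simp_all add: L_elem_def C_elem_def lvir_bracket_single)

lemmas lvir_bracket_elems =
  lvir_bracket_L_L lvir_bracket_L_C lvir_bracket_C_L lvir_bracket_C_C

lemmas lvir_bracket_add_right = lvir_pair.linear_add[OF lvir_bracket_linear_right]
  and lvir_bracket_scale_right = lvir_pair.linear_scale[OF lvir_bracket_linear_right]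
  and lvir_bracket_0_right = lvir_pair.linear_0[OF lvir_bracket_linear_right]


text \<open>The axioms need only be checked on the basis.\<close>

lemma basis_bracket_antisym: "basis_bracket a b = - basis_bracket b a"
proof (cases a; cases b)
  fix i j k l
  assume ab: "a = L_gen i j" "b = L_gen k l"
  have cube: "(of_int (i ^ 3 - i) / 12 :: complex) = - (of_int (k ^ 3 - k) / 12)" if "i + k = 0"
  proof -
    have "i = - k" using that by simp
    then show ?thesis by (simp add: field_simps)
  qed
  have diff: "(of_int (k - i) :: complex) = - of_int (i - k)" by simp
  show ?thesis
    unfolding ab basis_bracket.simps add.commute[of k i] add.commute[of l j] diff
    by (cases "i + k = 0")
      (simp_all only: cube lvir.scale_minus_left minus_add_distrib simp_thms if_True if_False minus_zero)
qed simp_all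

lemma lvir_bracket_antisym: "lvir_bracket x y = - lvir_bracket y x"
proof -
  have 1: "lvir_bracket (Poly_Mapping.single a 1) y = - lvir_bracket y (Poly_Mapping.single a 1)" for a
    by (rule lvir_linear_eqI[where x = y and s = lvir_scale])
      (intro lvir_bracket_linear_right lvir_pair.linear_compose_neg lvir_bracket_linear_left,
       intro lvir_bracket_linear_right lvir_pair.linear_compose_neg lvir_bracket_linear_left,
       unfold lvir_bracket_single, rule basis_bracket_antisym)
  show ?thesis
    by (rule lvir_linear_eqI[where x = x and s = lvir_scale])
      (intro lvir_bracket_linear_right lvir_pair.linear_compose_neg lvir_bracket_linear_left,
       intro lvir_bracket_linear_right lvir_pair.linear_compose_neg lvir_bracket_linear_left,
       rule 1)
qed

lemma lvir_bracket_self: "lvir_bracket x x = 0"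
proof (rule poly_mapping_eqI)
  fix a
  have "Poly_Mapping.lookup (lvir_bracket x x) a = - Poly_Mapping.lookup (lvir_bracket x x) a"
    by (metis lookup_uminus lvir_bracket_antisym)
  then show "Poly_Mapping.lookup (lvir_bracket x x) a = Poly_Mapping.lookup 0 a"
    by simp
qed

lemma lvir_bracket_L_L_L:
  "lvir_bracket (L_elem i j) (lvir_bracket (L_elem k l) (L_elem m n)) =
     lvir_scale (of_int ((m - k) * (k + m - i))) (L_elem (i + k + m) (j + l + n)) +
     (if i + k + m = 0
      then lvir_scale (of_int ((m - k) * (i ^ 3 - i)) / 12) (C_elem (j + l + n)) else 0)"
  by (simp add: lvir_bracket_elems lvir_bracket_add_right lvir_bracket_scale_right
      lvir_bracket_0_right lvir.scale_right_distrib add.assoc)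

lemma lvir_bracket_C_if: "lvir_bracket x (if P then lvir_scale c (C_elem l) else 0) = 0"
proof -
  have "lvir_bracket x (C_elem l) = 0"
  proof (rule lvir_linear_eqI[where x = x, OF lvir_bracket_linear_left lvir_pair.linear_zero])
    show "lvir_bracket (Poly_Mapping.single a 1) (C_elem l) = 0" for a
      by (cases a) (simp_all add: C_elem_def lvir_bracket_single)
  qed
  then show ?thesis by (simp add: lvir_bracket_scale_right lvir_bracket_0_right)
qed

lemma jacobi_L:
  fixes i j k l m n :: int
  defines "x \<equiv> L_elem i j" and "y \<equiv> L_elem k l" and "z \<equiv> L_elem m n"
  shows "lvir_bracket x (lvir_bracket y z) + lvir_bracket y (lvir_bracket z x) +
    lvir_bracket z (lvir_bracket x y) = 0"
proof -
  have idx: "k + m + i = i + k + m" "m + i + k = i + k + m"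
    "l + n + j = j + l + n" "n + j + l = j + l + n"
    by simp_all
  have L: "(m - k) * (k + m - i) + (i - m) * (m + i - k) + (k - i) * (i + k - m) = 0"
    by (simp add: algebra_simps)
  have C: "(m - k) * (i ^ 3 - i) + (i - m) * (k ^ 3 - k) + (k - i) * (m ^ 3 - m) = 0"
    if "i + k + m = 0"
  proof -
    have m: "m = - i - k" using that by simp
    show ?thesis unfolding m by (simp add: algebra_simps power3_eq_cube)
  qed
  let ?L = "L_elem (i + k + m) (j + l + n)" and ?C = "C_elem (j + l + n)"
  have sum_L: "lvir_scale (of_int ((m - k) * (k + m - i))) ?L +
      lvir_scale (of_int ((i - m) * (m + i - k))) ?L +
      lvir_scale (of_int ((k - i) * (i + k - m))) ?L = 0"
    unfolding lvir.scale_left_distrib[symmetric] of_int_add[symmetric] L by simp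
  have sum_C: "lvir_scale (of_int ((m - k) * (i ^ 3 - i)) / 12) ?C +
      lvir_scale (of_int ((i - m) * (k ^ 3 - k)) / 12) ?C +
      lvir_scale (of_int ((k - i) * (m ^ 3 - m)) / 12) ?C = 0" if "i + k + m = 0"
    unfolding lvir.scale_left_distrib[symmetric] of_int_add[symmetric]
      add_divide_distrib[symmetric] C[OF that] by simp
  have rearr: "(a + a') + (b + b') + (c + c') = (a + b + c) + (a' + b' + c')"
    for a b c a' b' c' :: lvir
    by (simp add: algebra_simps)
  show ?thesis
    unfolding x_def y_def z_def lvir_bracket_L_L_L idx rearr sum_L
    by (cases "i + k + m = 0") (simp_all only: if_True if_False sum_C simp_thms add_0_right)
qed

lemma lvir_jacobi:
  "lvir_bracket x (lvir_bracket y z) + lvir_bracket y (lvir_bracket z x) +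
    lvir_bracket z (lvir_bracket x y) = 0"
proof -
  define J where "J x y z = lvir_bracket x (lvir_bracket y z) + lvir_bracket y (lvir_bracket z x) +
    lvir_bracket z (lvir_bracket x y)" for x y z
  have zero: "Vector_Spaces.linear lvir_scale lvir_scale (\<lambda>x. 0)"
    by (rule lvir_pair.linear_zero)
  have lin: "Vector_Spaces.linear lvir_scale lvir_scale (\<lambda>x. J x y z)" for y z
    unfolding J_def
    by (intro lvir_pair.linear_compose_add lvir_bracket_linear_left
        Vector_Spaces.linear_compose[OF lvir_bracket_linear_right lvir_bracket_linear_right, unfolded o_def]
        Vector_Spaces.linear_compose[OF lvir_bracket_linear_left lvir_bracket_linear_right, unfolded o_def])
  have cyc: "J x y z = J y z x" for x y z
    unfolding J_def by (simp add: add_ac)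
  have C_right: "lvir_bracket x (C_elem l) = 0" for x l
    using lvir_bracket_C_if[of x True 1 l] by simp
  have C_left: "lvir_bracket (C_elem l) x = 0" for x l
    by (subst lvir_bracket_antisym) (simp add: C_right)
  have basis: "J (Poly_Mapping.single a 1) (Poly_Mapping.single b 1) (Poly_Mapping.single c 1) = 0" for a b c
  proof -
    have "(\<exists>i j. a = L_gen i j) \<and> (\<exists>k l. b = L_gen k l) \<and> (\<exists>m n. c = L_gen m n) \<or>
        (\<exists>j. a = C_gen j) \<or> (\<exists>j. b = C_gen j) \<or> (\<exists>j. c = C_gen j)"
      by (meson lvir_basis.exhaust)
    then show ?thesis
    proof (elim disjE conjE exE)
      fix i j k l m n
      assume abc: "a = L_gen i j" "b = L_gen k l" "c = L_gen m n"
      show ?thesis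
        unfolding J_def abc L_elem_def[symmetric] by (rule jacobi_L)
    qed (simp_all add: J_def C_elem_def[symmetric] C_left C_right lvir_bracket_0_right)
  qed
  have "J x (Poly_Mapping.single b 1) (Poly_Mapping.single c 1) = 0" for x b c
    by (rule lvir_linear_eqI[where s = lvir_scale, OF lin zero basis])
  then have "J x y (Poly_Mapping.single c 1) = 0" for x y c
    using lvir_linear_eqI[where s = lvir_scale and x = y, OF lin zero, of "Poly_Mapping.single c 1" x] cyc
    by metis
  then have "J x y z = 0"
    using lvir_linear_eqI[where s = lvir_scale and x = z, OF lin zero, of x y] cyc
    by metis
  then show ?thesis by (simp add: J_def)
qed

lemma lie_algebra_lvir: "lie_algebra lvir_scale lvir_bracket"
  by (intro lie_algebra.intro lie_algebra_axioms.intro vector_space_lvir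
      lvir_bracket_linear_left lvir_bracket_linear_right lvir_bracket_self lvir_jacobi)

lemma Omega_L_elem:
  "Omega lam mu al (L_elem i j) f =
    smult (lam powi (i - j) * mu powi j)
       ([:- (of_int i * al), 1:] * pcompose f [:- of_int i, 1:])"
  by (simp add: Omega_def L_elem_def lin_ext_single vector_space_smult)

lemma Omega_C_elem: "Omega lam mu al (C_elem j) f = 0"
  by (simp add: Omega_def C_elem_def lin_ext_single vector_space_smult)

lemma lvir_module_Omega:
  assumes "lam \<noteq> 0" "mu \<noteq> 0"
  shows "lvir_module smult (Omega lam mu al)"
proof -
  interpret S: vector_space "smult :: complex \<Rightarrow> _" by (rule vector_space_smult)
  interpret SS: vector_space_pair "smult :: complex \<Rightarrow> _" "smult :: complex \<Rightarrow> _" ..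
  interpret LS: vector_space_pair lvir_scale "smult :: complex \<Rightarrow> _" ..
  have basis_lin: "Vector_Spaces.linear smult smult (Omega_basis lam mu al a)" for a
    unfolding Vector_Spaces.linear_iff
    by (cases a) (simp_all add: vector_space_smult pcompose_add pcompose_smult smult_add_right algebra_simps)
  have right: "Vector_Spaces.linear smult smult (Omega lam mu al x)" for x
    unfolding Omega_def[abs_def]
    by (intro linear_lin_ext_param vector_space_smult basis_lin)
  have left: "Vector_Spaces.linear lvir_scale smult (\<lambda>x. Omega lam mu al x f)" for f
    unfolding Omega_def by (intro linear_lin_ext vector_space_smult)
  note lin_simps = SS.linear_0[OF right] LS.linear_add[OF left] LS.linear_scale[OF left]
    LS.linear_0[OF left]
  have LL: "Omega lam mu al (lvir_bracket (L_elem i j) (L_elem k l)) f =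
      Omega lam mu al (L_elem i j) (Omega lam mu al (L_elem k l) f) -
      Omega lam mu al (L_elem k l) (Omega lam mu al (L_elem i j) f)" for i j k l f
  proof (rule poly_eq_poly_eq_iff[THEN iffD1], rule ext)
    fix t :: complex
    let ?c = "lam powi (i - j) * mu powi j" and ?d = "lam powi (k - l) * mu powi l"
    have cd: "lam powi (i + k - (j + l)) * mu powi (j + l) = ?c * ?d"
      using assms by (simp add: power_int_add power_int_diff)
    have P: "poly (Omega lam mu al (L_elem i j) f) t =
       lam powi (i - j) * mu powi j * ((t - of_int i * al) * poly f (t - of_int i))" for i j f t
      by (simp add: Omega_L_elem poly_pcompose algebra_simps)
    have C: "Omega lam mu al (if b then lvir_scale c (C_elem m) else 0) f = 0" for b c m
      by (simp add: lin_simps Omega_C_elem)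
    have arg: "t - of_int k - of_int i = t - of_int (i + k)" "t - of_int i - of_int k = t - of_int (i + k)"
      by simp_all
    show "poly (Omega lam mu al (lvir_bracket (L_elem i j) (L_elem k l)) f) t =
      poly (Omega lam mu al (L_elem i j) (Omega lam mu al (L_elem k l) f) -
        Omega lam mu al (L_elem k l) (Omega lam mu al (L_elem i j) f)) t"
      unfolding lvir_bracket_L_L lin_simps C poly_diff poly_add poly_smult P cd arg
      by (simp add: algebra_simps)
  qed
  have basis: "Omega lam mu al (lvir_bracket (Poly_Mapping.single a 1) (Poly_Mapping.single b 1)) f =
      Omega lam mu al (Poly_Mapping.single a 1) (Omega lam mu al (Poly_Mapping.single b 1) f) -
      Omega lam mu al (Poly_Mapping.single b 1) (Omega lam mu al (Poly_Mapping.single a 1) f)" for a b f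
    by (cases a; cases b)
      (simp_all only: L_elem_def[symmetric] C_elem_def[symmetric] LL lvir_bracket_L_C
        lvir_bracket_C_L lvir_bracket_C_C Omega_C_elem lin_simps diff_self)
  have comp: "Vector_Spaces.linear lvir_scale smult (\<lambda>x. Omega lam mu al y (Omega lam mu al x f))"
      and bra: "Vector_Spaces.linear lvir_scale smult (\<lambda>x. Omega lam mu al (lvir_bracket x y) f)"
      and bra': "Vector_Spaces.linear lvir_scale smult (\<lambda>x. Omega lam mu al (lvir_bracket y x) f)"
    for y f
    using Vector_Spaces.linear_compose[OF left right]
      Vector_Spaces.linear_compose[OF lvir_bracket_linear_left left]
      Vector_Spaces.linear_compose[OF lvir_bracket_linear_right left]
    unfolding o_def by blast+
  have half: "Omega lam mu al (lvir_bracket x (Poly_Mapping.single b 1)) f =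
      Omega lam mu al x (Omega lam mu al (Poly_Mapping.single b 1) f) -
      Omega lam mu al (Poly_Mapping.single b 1) (Omega lam mu al x f)" for x b f
    by (rule lvir_linear_eqI[where x = x, OF bra LS.linear_compose_sub[OF left comp] basis])
  have full: "Omega lam mu al (lvir_bracket x y) f =
      Omega lam mu al x (Omega lam mu al y f) - Omega lam mu al y (Omega lam mu al x f)" for x y f
    by (rule lvir_linear_eqI[where x = y, OF bra' LS.linear_compose_sub[OF comp left] half])
  show ?thesis
    by (intro lie_module.intro lie_module_axioms.intro lie_algebra_lvir vector_space_smult
        left right full)
qed

end

theory Submission
  imports Defs "HOL-Computational_Algebra.Fundamental_Theorem_Algebra"
begin

text \<open>
  Identify \<open>M\<close> with \<open>\<complex>[t]\<close> so that \<open>L\<^sub>0\<^sub>,\<^sub>0\<close> acts by multiplication by \<open>t\<close>. As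
  \<open>L\<^sub>i\<^sub>,\<^sub>j\<close> has weight \<open>i\<close>, it acts by \<open>f(t) \<mapsto> f(t - i) g\<^sub>i\<^sub>,\<^sub>j(t)\<close>, and \<open>C\<^sub>j\<close> acts by multiplication by
  a polynomial, which commutation with \<open>L\<^sub>1\<^sub>,\<^sub>0\<close> forces to be constant. Bracketing with \<open>L\<^sub>0\<^sub>,\<^sub>j\<close>
  gives \<open>g\<^sub>i\<^sub>,\<^sub>j = \<nu>\<^sup>j g\<^sub>i\<^sub>,\<^sub>0\<close>. The bracket of \<open>L\<^sub>i\<^sub>,\<^sub>0\<close> and \<open>L\<^sub>-\<^sub>i\<^sub>,\<^sub>0\<close> shows that the degrees of
  \<open>g\<^sub>i\<^sub>,\<^sub>0\<close> and \<open>g\<^sub>-\<^sub>i\<^sub>,\<^sub>0\<close> add up to \<open>2\<close>; neither is \<open>0\<close>, so both are \<open>1\<close>, and comparing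
  coefficients in the remaining relations yields \<open>g\<^sub>i\<^sub>,\<^sub>0 = \<lambda>\<^sup>i (t - i\<alpha>)\<close> and \<open>C = 0\<close>.
  In the notation of \<open>\<Omega>\<close>, \<open>\<mu> = \<lambda>\<nu>\<close>. For \<open>\<alpha> = 0\<close> the multiples of \<open>t\<close> form a submodule.
\<close>

section \<open>Shifts of polynomials\<close>

definition shift :: "int \<Rightarrow> complex poly \<Rightarrow> complex poly" where
  "shift k f = pcompose f [:- of_int k, 1:]"

lemma poly_shift [simp]: "poly (shift k f) x = poly f (x - of_int k)"
  by (simp add: shift_def poly_pcompose)

lemma degree_shift [simp]: "degree (shift k f) = degree f"
  by (simp add: shift_def degree_pcompose)

lemma shift_simps [simp]:
  "shift k 0 = 0" "shift k 1 = 1" "shift k [:c:] = [:c:]" "shift k (f + h) = shift k f + shift k h"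
  "shift k (f - h) = shift k f - shift k h" "shift k (f * h) = shift k f * shift k h"
  "shift k (smult c f) = smult c (shift k f)" "shift 0 f = f"
  by (simp_all add: shift_def pcompose_1 pcompose_add pcompose_diff pcompose_mult pcompose_smult
      pcompose_pCons)

text \<open>Such an \<open>f\<close> takes the value \<open>f(0)\<close> at all natural multiples of
  \<open>k\<close>, so \<open>f - f(0)\<close> would otherwise have infinitely many roots.\<close>

lemma shift_invariant_imp_const:
  assumes "shift k f = f" "k \<noteq> 0"
  shows "\<exists>c. f = [:c:]"
proof -
  have step: "poly f (of_nat n * of_int k) = poly f 0" for n
  proof (induction n)
    case (Suc n)
    have "poly f (of_nat (Suc n) * of_int k) = poly (shift k f) (of_nat (Suc n) * of_int k)"
      using assms(1) by simp
    also have "\<dots> = poly f (of_nat n * of_int k)"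
      by (simp add: algebra_simps)
    finally show ?case using Suc by simp
  qed simp
  have inj: "inj (\<lambda>n::nat. of_nat n * of_int k :: complex)"
    using assms(2) by (auto simp: inj_def)
  have "f - [:poly f 0:] = 0"
  proof (rule ccontr)
    assume "f - [:poly f 0:] \<noteq> 0"
    then have "finite {x. poly (f - [:poly f 0:]) x = 0}" by (rule poly_roots_finite)
    then have "finite (range (\<lambda>n::nat. of_nat n * of_int k :: complex))"
      by (rule rev_finite_subset) (auto simp: step)
    then show False using inj by (simp add: finite_image_iff)
  qed
  then show ?thesis by auto
qed

text \<open>Subtracting the linear polynomial with the same difference leaves a shift-invariant
  one.\<close>

lemma shift_diff_const:
  assumes "f - shift k f = [:d:]" "k \<noteq> 0"
  shows "\<exists>b. f = [:b, d / of_int k:]"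
proof -
  have "shift k (f - [:0, d / of_int k:]) = f - [:0, d / of_int k:]"
  proof (rule poly_eq_poly_eq_iff[THEN iffD1], rule ext)
    fix x
    have "poly f x - poly f (x - of_int k) = d"
      using arg_cong[OF assms(1), of "\<lambda>p. poly p x"] by simp
    then show "poly (shift k (f - [:0, d / of_int k:])) x = poly (f - [:0, d / of_int k:]) x"
      using assms(2) by (simp add: field_simps)
  qed
  then obtain b where "f - [:0, d / of_int k:] = [:b:]"
    using shift_invariant_imp_const assms(2) by blast
  then have "f = [:b:] + [:0, d / of_int k:]" by (simp add: algebra_simps)
  then show ?thesis by auto
qed

text \<open>Since \<open>t^2 - (t - k)^2 = 2kt - k^2\<close>, subtracting \<open>t^2\<close> reduces
  to a constant difference.\<close>

lemma shift_diff_linear: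
  assumes "f - shift k f = [:d, 2 * of_int k:]" "k \<noteq> 0"
  shows "degree f = 2"
proof -
  have "(f - [:0, 0, 1:]) - shift k (f - [:0, 0, 1:]) = [:d + of_int k ^ 2:]"
  proof (rule poly_eq_poly_eq_iff[THEN iffD1], rule ext)
    fix x
    have "poly f x - poly f (x - of_int k) = d + x * (2 * of_int k)"
      using arg_cong[OF assms(1), of "\<lambda>p. poly p x"] by simp
    then show "poly ((f - [:0, 0, 1:]) - shift k (f - [:0, 0, 1:])) x = poly [:d + of_int k ^ 2:] x"
      by (simp add: algebra_simps power2_eq_square)
  qed
  then obtain a b where "f - [:0, 0, 1:] = [:a, b:]"
    using shift_diff_const assms(2) by blast
  then have "f = [:a, b:] + [:0, 0, 1:]" by (simp add: algebra_simps)
  then show ?thesis by simp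
qed

lemma degree_shift_diff:
  assumes "degree f \<le> Suc n"
  shows "degree (shift k f - f) \<le> n"
proof (cases "degree f = 0")
  case True
  then show ?thesis by (auto elim!: degree_eq_zeroE)
next
  case False
  have "lead_coeff (shift k f) = lead_coeff f"
    unfolding shift_def by (subst lead_coeff_comp) auto
  then have "coeff (shift k f - f) (degree f) = 0" by simp
  moreover have "degree (shift k f - f) \<le> degree f"
    by (rule degree_diff_le) auto
  ultimately have "shift k f - f = 0 \<or> degree (shift k f - f) < degree f"
    using degree_less_if_less_eqI by blast
  then show ?thesis using assms False by auto
qed

lemma smult_inj:
  fixes p q :: "complex poly"
  assumes "smult b p = smult b q" "b \<noteq> 0"
  shows "p = q"
  using assms vector_space.scale_cancel_left[OF vector_space_smult] by blast

lemma int_multiplicative_powi: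
  fixes a :: "int \<Rightarrow> complex"
  assumes step: "\<And>n. a (n + 1) = a n * a 1" and "a 0 = 1"
  shows "a n = a 1 powi n"
proof -
  have 0: "a 1 \<noteq> 0" using step[of "-1"] assms(2) by auto
  show ?thesis
  proof (induction n rule: int_induct[where k = 0])
    case base
    then show ?case by (simp add: assms(2))
  next
    case (step1 i)
    then show ?case using 0 step by (simp add: power_int_add)
  next
    case (step2 i)
    then show ?case using 0 step[of "i - 1"] by (simp add: power_int_diff)
  qed
qed

section \<open>Module structures on the polynomial algebra\<close>

text \<open>The form a free module of rank one takes once its generator is identified with
  \<open>1\<close>.\<close>

locale poly_lvir_module = lie_module lvir_scale lvir_bracket smult A
  for A :: "lvir \<Rightarrow> complex poly \<Rightarrow> complex poly" +
  assumes A_L00: "A (L_elem 0 0) f = [:0, 1:] * f"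
begin

definition g :: "int \<Rightarrow> int \<Rightarrow> complex poly" where "g i j = A (L_elem i j) 1"

definition c :: "int \<Rightarrow> complex poly" where "c j = A (C_elem j) 1"

sublocale right: Vector_Spaces.linear smult smult "A x" for x
  by (rule act_linear_right)

sublocale left: Vector_Spaces.linear lvir_scale smult "\<lambda>x. A x f" for f
  by (rule act_linear_left)

text \<open>The weight relation amounts to \<open>A x (t f) = (t - i) (A x f)\<close>, so the image
  of \<open>1\<close> determines all others.\<close>

lemma A_weight:
  assumes "lvir_bracket (L_elem 0 0) x = lvir_scale (of_int i) x"
  shows "A x f = shift i f * A x 1"
proof (induction f)
  case 0
  then show ?case by (simp add: right.zero)
next
  case (pCons a f)
  have "smult (of_int i) (A x f) = [:0, 1:] * A x f - A x ([:0, 1:] * f)"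
    using act_bracket[of "L_elem 0 0" x f] unfolding assms left.scale A_L00 .
  then have X: "A x ([:0, 1:] * f) = [:- of_int i, 1:] * A x f"
    by (simp add: algebra_simps)
  have "pCons a f = smult a 1 + [:0, 1:] * f" by simp
  then have "A x (pCons a f) = A x (smult a 1 + [:0, 1:] * f)" by simp
  also have "\<dots> = smult a (A x 1) + [:- of_int i, 1:] * (shift i f * A x 1)"
    unfolding right.add right.scale X pCons ..
  also have "\<dots> = ([:a:] + [:- of_int i, 1:] * shift i f) * A x 1"
    by (simp only: distrib_right mult.assoc) simp
  also have "[:a:] + [:- of_int i, 1:] * shift i f = shift i (pCons a f)"
    by (simp add: shift_def pcompose_pCons)
  finally show ?case .
qed

lemma A_L: "A (L_elem i j) f = shift i f * g i j"
  unfolding g_def by (rule A_weight) (simp add: lvir_bracket_L_L)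

lemma A_C: "A (C_elem j) f = f * c j"
  using A_weight[of "C_elem j" 0 f] by (simp add: lvir_bracket_L_C c_def)

text \<open>Evaluating the bracket of two \<open>L_elem\<close> at \<open>1\<close> turns the
  relations into polynomial identities.\<close>

lemma g_bracket:
  "shift i (g k l) * g i j - shift k (g i j) * g k l =
     smult (of_int (k - i)) (g (i + k) (j + l)) +
     (if i + k = 0 then smult (of_int (i ^ 3 - i) / 12) (c (j + l)) else 0)"
proof -
  have "A (lvir_bracket (L_elem i j) (L_elem k l)) 1 =
      A (L_elem i j) (A (L_elem k l) 1) - A (L_elem k l) (A (L_elem i j) 1)"
    by (rule act_bracket)
  moreover have "A (lvir_bracket (L_elem i j) (L_elem k l)) 1 =
      smult (of_int (k - i)) (g (i + k) (j + l)) +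
      (if i + k = 0 then smult (of_int (i ^ 3 - i) / 12) (c (j + l)) else 0)"
    by (simp add: lvir_bracket_L_L left.add left.scale g_def c_def)
  ultimately show ?thesis by (simp add: A_L)
qed

lemma g_00: "g 0 0 = [:0, 1:]"
  by (simp add: g_def A_L00)

lemma c_shift: "shift i (c l) * g i j = c l * g i j"
  using act_bracket[of "L_elem i j" "C_elem l" 1]
  by (simp add: lvir_bracket_L_C left.zero A_L A_C mult.commute)

text \<open>The bracket of \<open>L_elem 1 j\<close> and \<open>L_elem (-1) (- j)\<close> has no
  central term as \<open>1^3 - 1 = 0\<close>, so \<open>g 1 j = 0\<close> would force
  \<open>-2t = 0\<close>.\<close>

lemma g_1_nonzero: "g 1 j \<noteq> 0"
  using g_bracket[of 1 "-1" "-j" j] by (auto simp: g_00)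

lemma c_const: "\<exists>a. c l = [:a:]"
  using c_shift[of 1 l 0] g_1_nonzero[of 0] by (intro shift_invariant_imp_const[of 1]) auto

text \<open>A central term may now occur, but it is constant and cannot cancel
  \<open>-2it\<close>.\<close>

lemma g_nonzero: "g i j \<noteq> 0" if "i \<noteq> 0"
proof
  assume "g i j = 0"
  moreover obtain a where "c 0 = [:a:]" using c_const by blast
  ultimately show False
    using g_bracket[of i "-i" "-j" j] that by (auto simp: g_00)
qed

section \<open>Dependence on the loop index\<close>

lemma g_0_diff: "(g 0 j - shift k (g 0 j)) * g k l = smult (of_int k) (g k (j + l))"
  using g_bracket[of 0 k l j] by (simp add: algebra_simps)

lemma g_0_linear:
  obtains a b where "a \<noteq> 0" "g 0 j = [:b, a:]"
proof -
  let ?d = "\<lambda>j. g 0 j - shift 1 (g 0 j)"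
  \<comment> \<open>By \<open>g_0_diff\<close>, \<open>?d (- j)\<close> and \<open>?d j\<close> move
    the second index back and forth, so \<open>?d j\<close> is a unit, hence a constant.\<close>
  have "?d j * ?d (- j) * g 1 0 = ?d j * g 1 (- j)"
    using g_0_diff[of "- j" 1 0] by (simp add: mult.assoc)
  also have "\<dots> = g 1 0" using g_0_diff[of j 1 "- j"] by simp
  finally have "?d j * ?d (- j) = 1" using g_1_nonzero[of 0] by simp
  then have "?d j dvd 1" by (metis dvdI)
  then obtain a where a: "?d j = [:a:]" "a \<noteq> 0"
    by (metis degree_eq_zeroE is_unit_iff_degree not_is_unit_0 pCons_0_0)
  then obtain b where "g 0 j = [:b, a / of_int 1:]" using shift_diff_const by fastforce
  with a show thesis using that by simp
qed

text \<open>This will be the \<open>j\<close>-th power of \<nu>, the scalar gained when the second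
  index grows by \<open>j\<close>.\<close>

definition slope :: "int \<Rightarrow> complex" where "slope j = coeff (g 0 j) 1"

lemma slope_nonzero: "slope j \<noteq> 0"
  by (rule g_0_linear[of j]) (simp add: slope_def)

lemma g_add: "g k (j + l) = smult (slope j) (g k l)" if "k \<noteq> 0"
proof -
  obtain a b where ab: "g 0 j = [:b, a:]" using g_0_linear by metis
  then have "g 0 j - shift k (g 0 j) = [:of_int k * a:]"
    by (simp add: shift_def pcompose_pCons algebra_simps)
  then have "smult (of_int k) (g k (j + l)) = smult (of_int k) (smult a (g k l))"
    using g_0_diff[of j k l] by simp
  from smult_inj[OF this] show ?thesis using that ab by (simp add: slope_def)
qed

lemma slope_add: "slope (j + l) = slope j * slope l"
proof -
  have "smult (slope (j + l)) (g 1 0) = g 1 (j + l)"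
    using g_add[of 1 "j + l" 0] by simp
  also have "\<dots> = smult (slope j * slope l) (g 1 0)"
    using g_add[of 1 j l] g_add[of 1 l 0] by simp
  finally have "smult (slope (j + l) - slope j * slope l) (g 1 0) = 0"
    by (simp add: smult_diff_left)
  then show ?thesis using g_1_nonzero[of 0] by simp
qed

lemma slope_powi: "slope j = slope 1 powi j"
  by (rule int_multiplicative_powi) (simp_all add: slope_add, simp add: slope_def g_00)

lemma g_factor: "g i j = smult (slope 1 powi j) (g i 0)"
proof (cases "i = 0")
  case False
  then show ?thesis using g_add[of i j 0] slope_powi[of j] by simp
next
  case True
  \<comment> \<open>\<open>g_add\<close> does not reach \<open>i = 0\<close>; \<open>g 0 j\<close>
    is recovered from the bracket of \<open>L_elem 1 j\<close> and \<open>L_elem (-1) 0\<close>,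
    which has no central term.\<close>
  have g1: "g 1 j = smult (slope j) (g 1 0)" using g_add[of 1 j 0] by simp
  have "smult (-2) (g 0 j) = shift 1 (g (-1) 0) * g 1 j - shift (-1) (g 1 j) * g (-1) 0"
    using g_bracket[of 1 "-1" 0 j] by simp
  also have "\<dots> = smult (slope j) (shift 1 (g (-1) 0) * g 1 0 - shift (-1) (g 1 0) * g (-1) 0)"
    by (simp add: g1 smult_diff_right)
  also have "\<dots> = smult (-2) (smult (slope j) (g 0 0))"
    using g_bracket[of 1 "-1" 0 0] by (simp add: mult.commute)
  finally have "g 0 j = smult (slope j) (g 0 0)" by (rule smult_inj) simp
  then show ?thesis using True slope_powi[of j] by simp
qed

text \<open>Index \<open>2\<close> is the least positive one whose central coefficient
  \<open>(i^3 - i) / 12\<close> is nonzero; \<open>g_factor\<close> handles the other term of that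
  bracket.\<close>

lemma c_factor: "c j = smult (slope 1 powi j) (c 0)"
proof -
  let ?s = "slope 1 powi j"
  have "smult ?s (shift 2 (g (-2) 0) * g 2 0 - shift (-2) (g 2 0) * g (-2) 0) =
      shift 2 (g (-2) 0) * g 2 j - shift (-2) (g 2 j) * g (-2) 0"
    unfolding g_factor[of 2 j] by (simp add: smult_diff_right)
  then have "smult ?s (smult (-4) (g 0 0) + smult (1/2) (c 0)) = smult (-4) (g 0 j) + smult (1/2) (c j)"
    unfolding g_bracket by simp
  also have "smult ?s (smult (-4) (g 0 0) + smult (1/2) (c 0)) =
      smult (-4) (g 0 j) + smult (1/2) (smult ?s (c 0))"
    unfolding g_factor[of 0 j] by (simp add: smult_add_right smult_diff_right mult.commute)
  finally have "smult (1/2) (smult ?s (c 0)) = smult (1/2) (c j)" by (rule add_left_imp_eq)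
  from smult_inj[OF this] show ?thesis by simp
qed

section \<open>The Virasoro subalgebra\<close>

lemma degree_g_pair: "degree (g i 0) + degree (g (- i) 0) = 2" if "i \<noteq> 0"
proof -
  let ?h = "shift i (g (- i) 0) * g i 0"
  obtain a where a: "c 0 = [:a:]" using c_const by blast
  \<comment> \<open>So the two products in the bracket are \<open>?h\<close> and its shift by
    \<open>- i\<close>; their difference, \<open>-2it\<close> plus a constant, makes
    \<open>?h\<close> quadratic.\<close>
  have h: "shift (- i) ?h = shift (- i) (g i 0) * g (- i) 0"
    by (rule poly_eq_poly_eq_iff[THEN iffD1], rule ext) simp
  have "?h - shift (- i) ?h = [:of_int (i ^ 3 - i) / 12 * a, 2 * of_int (- i):]"
    unfolding h g_bracket by (simp add: g_00 a)
  then have "degree ?h = 2"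
    by (rule shift_diff_linear) (simp add: that)
  moreover have "shift i (g (- i) 0) \<noteq> 0"
    using g_nonzero[of "- i" 0] that \<open>degree ?h = 2\<close> by auto
  ultimately show ?thesis
    using g_nonzero[OF that, of 0] by (simp add: degree_mult_eq)
qed

text \<open>If \<open>L\<^sub>i\<close> acted by a constant times a shift, bracketing with it would lower degrees, so
  some \<open>L\<^sub>m\<^sub>i\<close> would act by zero.\<close>

lemma degree_g_not_0: "degree (g i 0) \<noteq> 0" if "i \<noteq> 0"
proof
  assume "degree (g i 0) = 0"
  then obtain a where a: "g i 0 = [:a:]" by (rule degree_eq_zeroE)
  have step: "smult a (shift i (g k 0) - g k 0) = smult (of_int (k - i)) (g (i + k) 0)"
    if "i + k \<noteq> 0" for k
    using g_bracket[of i k 0 0] that a by (simp add: smult_diff_right)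
  have lower: "degree (g (i + k) 0) \<le> n" if "degree (g k 0) \<le> Suc n" "i + k \<noteq> 0" "k \<noteq> i" for k n
  proof -
    have "degree (smult (of_int (k - i)) (g (i + k) 0)) \<le> n"
      using degree_smult_le[of a "shift i (g k 0) - g k 0"] degree_shift_diff[OF that(1), of i]
        step[OF that(2)] by (metis order_trans)
    then show ?thesis using that(3) by (simp split: if_splits)
  qed
  \<comment> \<open>The chain starts at \<open>2 * i\<close>, as \<open>k = i\<close> gives a zero
    bracket. The degrees at \<open>2i\<close>, \<open>3i\<close>, \<open>4i\<close> are at most
    \<open>2\<close>, \<open>1\<close>, \<open>0\<close>, and \<open>g\<close> vanishes at
    \<open>5i\<close>.\<close>
  have "degree (g (2 * i) 0) \<le> Suc (Suc 0)"
    using degree_g_pair[of "2 * i"] that by simp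
  then have "degree (g (3 * i) 0) \<le> Suc 0"
    using lower[of "2 * i"] that by simp
  then have "degree (g (4 * i) 0) \<le> 0"
    using lower[of "3 * i" 0] that by simp
  then obtain b where "g (4 * i) 0 = [:b:]" by (auto elim: degree_eq_zeroE)
  then have "g (5 * i) 0 = 0"
    using step[of "4 * i"] that by simp
  then show False using g_nonzero[of "5 * i" 0] that by simp
qed

lemma degree_g: "degree (g i 0) = 1"
proof (cases "i = 0")
  case False
  then show ?thesis
    using degree_g_pair[of i] degree_g_not_0[of i] degree_g_not_0[of "- i"] by simp
qed (simp add: g_00)

text \<open>With degree one known, \<open>g i 0\<close> is \<open>a i * (t + e i)\<close>; the goal
  is \<open>a i = \<lambda>^i\<close> and \<open>e i = - i * \<alpha>\<close>.\<close>

definition a :: "int \<Rightarrow> complex" where "a i = coeff (g i 0) 1"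

definition e :: "int \<Rightarrow> complex" where "e i = coeff (g i 0) 0 / a i"

lemma a_nonzero: "a i \<noteq> 0"
proof
  assume "a i = 0"
  then have "g i 0 = 0"
    using degree_g[of i] leading_coeff_0_iff[of "g i 0"] by (simp add: a_def)
  then show False using degree_g[of i] by simp
qed

lemma g_eq: "g i 0 = smult (a i) [:e i, 1:]"
proof (rule poly_eqI)
  fix n
  show "coeff (g i 0) n = coeff (smult (a i) [:e i, 1:]) n"
  proof (cases n)
    case 0
    then show ?thesis using a_nonzero[of i] by (simp add: e_def)
  next
    case (Suc m)
    then show ?thesis
      using degree_g[of i] by (cases m) (auto simp: a_def coeff_eq_0)
  qed
qed

lemma a_0: "a 0 = 1" and e_0: "e 0 = 0"
  by (simp_all add: a_def e_def g_00)

text \<open>The linear coefficients lead to \<open>a_mult\<close>, the constant ones to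
  \<open>e_rec\<close>; the central term, being constant, touches only the latter.\<close>

lemma ae_bracket:
  "[:a i * a k * (of_int k * e k - of_int i * e i), a i * a k * of_int (k - i):] =
     [:of_int (k - i) * a (i + k) * e (i + k), of_int (k - i) * a (i + k):] +
     (if i + k = 0 then smult (of_int (i ^ 3 - i) / 12) (c 0) else 0)"
proof -
  have lhs: "shift i (g k 0) * g i 0 - shift k (g i 0) * g k 0 =
      [:a i * a k * (of_int k * e k - of_int i * e i), a i * a k * of_int (k - i):]"
    unfolding g_eq by (simp add: shift_def pcompose_pCons algebra_simps)
  have rhs: "smult (of_int (k - i)) (g (i + k) 0) =
      [:of_int (k - i) * a (i + k) * e (i + k), of_int (k - i) * a (i + k):]"
    unfolding g_eq by simp
  show ?thesis using g_bracket[of i k 0 0] unfolding add_0_right lhs rhs .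
qed

lemma a_mult: "a (i + k) = a i * a k" if "i \<noteq> k"
proof -
  have "coeff (if i + k = 0 then smult (of_int (i ^ 3 - i) / 12) (c 0) else 0) 1 = 0"
    using c_const[of 0] by auto
  then have "a i * a k * of_int (k - i) = of_int (k - i) * a (i + k)"
    using arg_cong[OF ae_bracket[of i k], of "\<lambda>p. coeff p 1"] by simp
  then show ?thesis using that by auto
qed

lemma a_powi: "a i = a 1 powi i"
proof (rule int_multiplicative_powi)
  \<comment> \<open>\<open>a_mult\<close> excludes \<open>1 + 1\<close>; comparing
    \<open>5 = (3 + 1) + 1\<close> with \<open>5 = 3 + 2\<close> determines
    \<open>a 2\<close>.\<close>
  have "a 3 * (a 1 * a 1) = a 3 * a 2"
    using a_mult[of 4 1] a_mult[of 3 1] a_mult[of 3 2] by simp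
  then have "a 2 = a 1 * a 1" using a_nonzero[of 3] by simp
  then show "a (n + 1) = a n * a 1" for n
    using a_mult[of n 1] by (cases "n = 1") auto
qed (rule a_0)

lemma e_rec: "of_int k * e k - of_int i * e i = of_int (k - i) * e (i + k)" if "i + k \<noteq> 0" "i \<noteq> k"
proof -
  have "a i * a k * (of_int k * e k - of_int i * e i) = of_int (k - i) * a (i + k) * e (i + k)"
    using arg_cong[OF ae_bracket[of i k], of "\<lambda>p. coeff p 0"] that(1) by simp
  also have "\<dots> = a i * a k * (of_int (k - i) * e (i + k))"
    unfolding a_mult[OF that(2)] by (simp only: mult_ac)
  finally show ?thesis using a_nonzero[of i] a_nonzero[of k] by simp
qed

lemma e_minus_1: "e (-1) = - e 1"
proof -
  have "- e (-1) = e 1"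
    using arg_cong[OF ae_bracket[of 1 "-1"], of "\<lambda>p. coeff p 0"] a_nonzero[of 1] a_nonzero[of "-1"]
    by (auto simp: e_0)
  then show ?thesis by (metis minus_minus)
qed

lemma e_linear: "e k = of_int k * e 1"
proof -
  \<comment> \<open>The recurrence \<open>step\<close> at \<open>k = 1\<close> leaves
    \<open>e 2\<close> open, so the pair \<open>2\<close>, \<open>-1\<close> supplies it; downwards
    it leaves \<open>e 0\<close> open, known from \<open>e_0\<close>.\<close>
  have e2: "e 2 = 2 * e 1"
    using e_rec[of 2 "-1"] by (simp add: e_minus_1)
  have step: "of_int k * e k - e 1 = of_int (k - 1) * e (k + 1)" for k
    using e_rec[of k 1] e_minus_1 e_0
    by (cases "k = 1 \<or> k = -1") (auto simp: algebra_simps)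
  show ?thesis
  proof (induction k rule: int_induct[where k = 1])
    case (step1 i)
    show ?case
    proof (cases "i = 1")
      case False
      have "of_int (i - 1) * e (i + 1) = of_int (i - 1) * (of_int (i + 1) * e 1)"
        unfolding step[symmetric] step1 by (simp add: algebra_simps)
      then show ?thesis using False by simp
    qed (simp add: e2)
  next
    case (step2 i)
    show ?case
    proof (cases "i = 1")
      case False
      have "of_int (i - 1) * e (i - 1) = e 1 + of_int (i - 2) * (of_int i * e 1)"
        using step[of "i - 1"] step2 by (simp add: algebra_simps)
      also have "\<dots> = of_int (i - 1) * (of_int (i - 1) * e 1)"
        by (simp add: algebra_simps)
      finally show ?thesis using False by simp
    qed (simp add: e_0)
  qed simp
qed

text \<open>In the bracket of \<open>L_elem 2 0\<close> and \<open>L_elem (-2) 0\<close>, the known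
  values of \<open>e\<close> cancel and leave only the central constant.\<close>

lemma c_zero: "c j = 0"
proof -
  have e: "e 2 = 2 * e 1" "e (-2) = -2 * e 1"
    using e_linear[of 2] e_linear[of "-2"] by simp_all
  obtain b where b: "c 0 = [:b:]" using c_const by blast
  have "c 0 = 0"
    using arg_cong[OF ae_bracket[of 2 "-2"], of "\<lambda>p. coeff p 0"] b by (simp add: e_0 e)
  then show ?thesis by (simp add: c_factor[of j])
qed

lemma eq_Omega: "\<exists>lam mu al. lam \<noteq> 0 \<and> mu \<noteq> 0 \<and> A = Omega lam mu al"
proof (intro exI conjI ext)
  \<comment> \<open>The factor \<open>a 1\<close> in \<open>?mu\<close> offsets the
    \<open>- j\<close> in \<open>lam powi (i - j)\<close>; the sign of \<open>?al\<close> comes from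
    \<open>e i = - i * al\<close>.\<close>
  let ?lam = "a 1" and ?mu = "a 1 * slope 1" and ?al = "- e 1"
  show "?lam \<noteq> 0" "?mu \<noteq> 0" by (simp_all add: a_nonzero slope_nonzero)
  fix x f
  have lin: "Vector_Spaces.linear lvir_scale smult (\<lambda>x. Omega ?lam ?mu ?al x f)"
    unfolding Omega_def by (rule linear_lin_ext[OF vector_space_smult])
  have "?lam powi (i - j) * ?mu powi j = ?lam powi i * slope 1 powi j" for i j
    using a_nonzero[of 1] by (simp add: power_int_mult_distrib power_int_diff)
  then have "A (L_elem i j) f = Omega ?lam ?mu ?al (L_elem i j) f" for i j
    unfolding A_L Omega_L_elem g_factor[of i j] g_eq a_powi[of i] e_linear[of i]
    by (simp add: shift_def[symmetric] smult_add_right mult_ac)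
  moreover have "A (C_elem j) f = Omega ?lam ?mu ?al (C_elem j) f" for j
    by (simp add: A_C c_zero Omega_C_elem)
  ultimately have "A (Poly_Mapping.single b 1) f = Omega ?lam ?mu ?al (Poly_Mapping.single b 1) f" for b
    by (cases b) (simp_all add: L_elem_def C_elem_def)
  then show "A x f = Omega ?lam ?mu ?al x f"
    by (rule lvir_linear_eqI[OF act_linear_left lin])
qed

end

section \<open>Simplicity\<close>

lemma Omega_0_not_simple: "\<not> simple_lie_module smult (Omega lam mu 0)"
proof
  assume simple: "simple_lie_module smult (Omega lam mu 0)"
  let ?N = "{f :: complex poly. poly f 0 = 0}"
  interpret S: vector_space "smult :: complex \<Rightarrow> _" by (rule vector_space_smult)
  \<comment> \<open>For \<open>al = 0\<close> every \<open>L_gen\<close> operator carries the factor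
    \<open>t\<close>.\<close>
  have "poly (Omega_basis lam mu 0 b f) 0 = 0" for b f by (cases b) auto
  then have "lie_submodule smult (Omega lam mu 0) ?N"
    by (auto simp: lie_submodule_def S.subspace_def Omega_def lin_ext_def poly_sum)
  then have "?N = {0} \<or> ?N = UNIV" using simple by (simp add: simple_lie_module_def)
  moreover have "[:0, 1:] \<in> ?N" "[:0, 1:] \<noteq> (0 :: complex poly)" "1 \<notin> ?N" by auto
  ultimately show False by blast
qed

text \<open>A submodule is an ideal; if a root \<open>r\<close> of its generator existed, then so would the roots
  \<open>r - i\<close> for all but at most one integer \<open>i\<close>.\<close>

lemma Omega_simple:
  assumes "lam \<noteq> 0" "mu \<noteq> 0" "al \<noteq> 0"
  shows "simple_lie_module smult (Omega lam mu al)"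
  unfolding simple_lie_module_def
proof (intro conjI allI impI)
  have "(1 :: complex poly) \<noteq> 0" by simp
  then show "(UNIV :: complex poly set) \<noteq> {0}" by blast
next
  fix N :: "complex poly set"
  assume N: "lie_submodule smult (Omega lam mu al) N"
  interpret S: vector_space "smult :: complex \<Rightarrow> _" by (rule vector_space_smult)
  have sub: "S.subspace N" and inv: "f \<in> N \<Longrightarrow> Omega lam mu al x f \<in> N" for x f
    using N by (auto simp: lie_submodule_def)
  have X: "[:0, 1:] * f \<in> N" if "f \<in> N" for f
    using inv[OF that, of "L_elem 0 0"] by (simp add: Omega_L_elem pcompose_pCons flip: shift_def)
  have ideal: "p * f \<in> N" if "f \<in> N" for p f
  proof (induction p)
    case 0
    then show ?case using S.subspace_0[OF sub] by simp
  next
    case (pCons b p)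
    have "pCons b p * f = smult b f + [:0, 1:] * (p * f)" by simp
    then show ?case
      using S.subspace_add[OF sub S.subspace_scale[OF sub that] X[OF pCons.IH]] by metis
  qed
  show "N = {0} \<or> N = UNIV"
  proof (cases "\<exists>f\<in>N. f \<noteq> 0")
    case False
    then show ?thesis using S.subspace_0[OF sub] by auto
  next
    case True
    then obtain f where f: "f \<in> N" "f \<noteq> 0"
      and min: "\<And>h. h \<in> N \<Longrightarrow> h \<noteq> 0 \<Longrightarrow> degree f \<le> degree h"
      using ex_has_least_nat[of "\<lambda>h. h \<in> N \<and> h \<noteq> 0" _ degree] by blast
    have dvd: "f dvd h" if "h \<in> N" for h
    proof -
      have "h mod f = h - (h div f) * f" by (simp add: minus_div_mult_eq_mod)
      then have "h mod f \<in> N" using S.subspace_diff[OF sub that ideal[OF f(1)]] by metis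
      then have "h mod f = 0" using min degree_mod_less[OF f(2), of h] by force
      then show ?thesis by (simp add: dvd_eq_mod_eq_0)
    qed
    have "degree f = 0"
    proof (rule ccontr)
      assume "degree f \<noteq> 0"
      then obtain r where r: "poly f r = 0"
        using fundamental_theorem_of_algebra[of f] by (auto simp: constant_degree)
      \<comment> \<open>\<open>f\<close> divides its image under \<open>L_elem i 0\<close>, whose
        value at \<open>r\<close> is a nonzero multiple of
        \<open>(r - i * al) * f(r - i)\<close>.\<close>
      have root: "poly f (r - of_int i) = 0" if "r \<noteq> of_int i * al" for i
      proof -
        have "poly (Omega lam mu al (L_elem i 0) f) r = 0"
          using dvd[OF inv[OF f(1)]] r by (metis dvdE mult_zero_left poly_mult)
        then show ?thesis
          using that assms(1) by (simp add: Omega_L_elem poly_pcompose algebra_simps)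
      qed
      have "finite {i. r = of_int i * al}"
      proof (rule finite_subset)
        show "{i. r = of_int i * al} \<subseteq> of_int -` {r / al}" using assms(3) by auto
        show "finite (of_int -` {r / al} :: int set)"
          by (rule finite_vimageI) (auto simp: inj_def)
      qed
      then have "infinite (UNIV - {i. r = of_int i * al})"
        using infinite_UNIV_int Diff_infinite_finite by blast
      moreover have "inj_on (\<lambda>i. r - of_int i) X" for X by (auto simp: inj_on_def)
      ultimately have "infinite ((\<lambda>i. r - of_int i) ` (UNIV - {i. r = of_int i * al}))"
        by (simp add: finite_image_iff)
      moreover have "(\<lambda>i. r - of_int i) ` (UNIV - {i. r = of_int i * al}) \<subseteq> {x. poly f x = 0}"
        using root by auto
      ultimately show False using poly_roots_finite[OF f(2)] finite_subset by blast
    qed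
    then obtain b where "f = [:b:]" "b \<noteq> 0" using f(2) by (metis degree_eq_zeroE pCons_0_0)
    then have "h \<in> N" for h using ideal[OF f(1), of "smult (1 / b) h"] by simp
    then show ?thesis by auto
  qed
qed

section \<open>Transport along isomorphisms\<close>

lemma simple_lie_module_iso:
  fixes mscale :: "'f::field \<Rightarrow> 'm::ab_group_add \<Rightarrow> 'm"
    and nscale :: "'f \<Rightarrow> 'n::ab_group_add \<Rightarrow> 'n"
  assumes iso: "lie_module_iso mscale act nscale act'"
    and simple: "simple_lie_module nscale act'"
  shows "simple_lie_module mscale act"
proof -
  obtain \<phi> where lin: "Vector_Spaces.linear mscale nscale \<phi>" and bij: "bij \<phi>"
    and hom: "\<And>x v. \<phi> (act x v) = act' x (\<phi> v)"
    using iso by (auto simp: lie_module_iso_def)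
  interpret \<phi>: Vector_Spaces.linear mscale nscale \<phi> by fact
  have surj: "range \<phi> = UNIV" using bij by (simp add: bij_is_surj)
  show ?thesis
    unfolding simple_lie_module_def
  proof (intro conjI allI impI)
    show "UNIV \<noteq> {0 :: 'm}"
    proof
      assume "UNIV = {0 :: 'm}"
      then have "range \<phi> = \<phi> ` {0}" by simp
      then have "range \<phi> = {0}" by (simp add: \<phi>.zero)
      then show False using simple surj by (simp add: simple_lie_module_def)
    qed
  next
    fix N
    assume "lie_submodule mscale act N"
    then have "lie_submodule nscale act' (\<phi> ` N)"
      unfolding lie_submodule_def using \<phi>.subspace_image by (auto simp flip: hom)
    then have "\<phi> ` N = {0} \<or> \<phi> ` N = UNIV"
      using simple by (simp add: simple_lie_module_def)
    then have "\<phi> ` N = \<phi> ` {0} \<or> \<phi> ` N = \<phi> ` UNIV"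
      using surj by (simp add: \<phi>.zero)
    then show "N = {0} \<or> N = UNIV"
      unfolding inj_image_eq_iff[OF bij_is_inj[OF bij]] .
  qed
qed

lemma lie_module_iso_sym:
  assumes "lie_module_iso mscale act nscale act'"
  shows "lie_module_iso nscale act' mscale act"
proof -
  obtain \<phi> where lin: "Vector_Spaces.linear mscale nscale \<phi>" and bij: "bij \<phi>"
    and hom: "\<And>x v. \<phi> (act x v) = act' x (\<phi> v)"
    using assms by (auto simp: lie_module_iso_def)
  interpret \<phi>: Vector_Spaces.linear mscale nscale \<phi> by fact
  have inv: "\<phi> (inv \<phi> w) = w" "inv \<phi> (\<phi> v) = v" for v w
    using bij by (simp_all add: bij_is_surj surj_f_inv_f bij_is_inj)
  have eqI: "inv \<phi> w = v" if "\<phi> v = w" for v w using that inv by auto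
  show ?thesis
    unfolding lie_module_iso_def
  proof (intro exI[of _ "inv \<phi>"] conjI allI)
    show "Vector_Spaces.linear nscale mscale (inv \<phi>)"
      unfolding Vector_Spaces.linear_iff
      by (auto intro!: eqI \<phi>.vs1.vector_space_axioms \<phi>.vs2.vector_space_axioms
          simp: \<phi>.add \<phi>.scale inv)
    show "bij (inv \<phi>)" using bij by (rule bij_imp_bij_inv)
    show "inv \<phi> (act' x v) = act x (inv \<phi> v)" for x v
      by (intro eqI) (simp add: hom inv)
  qed
qed

lemma free_module_iso_Omega:
  fixes mscale :: "complex \<Rightarrow> 'm::ab_group_add \<Rightarrow> 'm"
  assumes mod: "lvir_module mscale act"
    and free: "free_of_rank_one (poly_action mscale (act (L_elem 0 0)))"
  shows "\<exists>lam mu al. lam \<noteq> 0 \<and> mu \<noteq> 0 \<and> lie_module_iso mscale act smult (Omega lam mu al)"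
proof -
  interpret M: lie_module lvir_scale lvir_bracket mscale act by fact
  let ?r = "poly_action mscale (act (L_elem 0 0))"
  note lin = M.act_linear_right[of "L_elem 0 0"]
  interpret R: module ?r by (rule module_poly_action[OF lin])
  interpret S: vector_space "smult :: complex \<Rightarrow> _" by (rule vector_space_smult)
  obtain v where indep: "\<not> R.dependent {v}" and span: "R.span {v} = UNIV"
    using free by (auto simp: free_of_rank_one_def)
  \<comment> \<open>Independence of \<open>{v}\<close> makes \<open>P\<close> injective and spanning
    makes it surjective; it carries multiplication by \<open>t\<close> to the action of
    \<open>L_elem 0 0\<close>.\<close>
  define P where "P f = ?r f v" for f
  have P_add: "P (f + h) = P f + P h" and P_smult: "P (smult b f) = mscale b (P f)"
    and P_X: "P ([:0, 1:] * f) = act (L_elem 0 0) (P f)" for f h b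
    unfolding P_def poly_action_mult[OF lin]
    by (simp_all only: poly_action_add_left[OF lin] poly_action_smult[OF lin] poly_action_X[OF lin])
  have "inj P"
  proof (rule injI)
    fix f h assume "P f = P h"
    then have "?r (f - h) v = 0" unfolding P_def R.scale_left_diff_distrib by simp
    then have "f - h = 0"
      using R.independentD[OF indep, of "{v}" "\<lambda>_. f - h" v] by simp
    then show "f = h" by simp
  qed
  moreover have "surj P"
    using span by (auto simp: P_def R.span_singleton)
  ultimately have bij: "bij P" by (simp add: bij_def)
  define Q where "Q = inv P"
  have PQ [simp]: "P (Q w) = w" and QP [simp]: "Q (P f) = f" for w f
    using bij by (simp_all add: Q_def bij_is_surj surj_f_inv_f bij_is_inj)
  have Q_eqI: "Q w = f" if "P f = w" for w f using that QP by blast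
  have lin_Q: "Vector_Spaces.linear mscale smult Q"
    unfolding Vector_Spaces.linear_iff
    by (auto intro!: Q_eqI M.M.vector_space_axioms vector_space_smult simp: P_add P_smult)
  have lin_P: "Vector_Spaces.linear smult mscale P"
    unfolding Vector_Spaces.linear_iff
    by (auto intro!: M.M.vector_space_axioms vector_space_smult simp: P_add P_smult)
  interpret Q: Vector_Spaces.linear mscale smult Q by fact
  define A where "A x f = Q (act x (P f))" for x f
  interpret A: poly_lvir_module A
  proof (intro poly_lvir_module.intro lie_module.intro lie_algebra_lvir vector_space_smult
      lie_module_axioms.intro poly_lvir_module_axioms.intro)
    show "Vector_Spaces.linear smult smult (A x)" for x
      using Vector_Spaces.linear_compose[OF Vector_Spaces.linear_compose[OF lin_P M.act_linear_right[of x]] lin_Q]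
      by (simp add: A_def[abs_def] o_def)
    show "Vector_Spaces.linear lvir_scale smult (\<lambda>x. A x f)" for f
      using Vector_Spaces.linear_compose[OF M.act_linear_left[of "P f"] lin_Q]
      by (simp add: A_def o_def)
    show "A (lvir_bracket x y) f = A x (A y f) - A y (A x f)" for x y f
      by (simp add: A_def M.act_bracket Q.diff)
    show "A (L_elem 0 0) f = [:0, 1:] * f" for f
      unfolding A_def by (rule Q_eqI) (rule P_X)
  qed
  obtain lam mu al where *: "lam \<noteq> 0" "mu \<noteq> 0" and A: "A = Omega lam mu al"
    using A.eq_Omega by blast
  have "bij Q" unfolding Q_def using bij by (rule bij_imp_bij_inv)
  then have "lie_module_iso mscale act smult A"
    unfolding lie_module_iso_def using lin_Q by (intro exI[of _ Q]) (simp add: A_def)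
  with * show ?thesis unfolding A by blast
qed

theorem theorem2p4:
  fixes mscale :: "complex \<Rightarrow> 'm::ab_group_add \<Rightarrow> 'm"
    and act :: "lvir \<Rightarrow> 'm \<Rightarrow> 'm"
  assumes "lvir_module mscale act"
    and "free_of_rank_one (poly_action mscale (act (L_elem 0 0)))"
  shows "(\<exists>lam mu al. lam \<noteq> 0 \<and> mu \<noteq> 0 \<and>
            lie_module_iso mscale act smult (Omega lam mu al)) \<and>
         (simple_lie_module mscale act \<longleftrightarrow>
            (\<exists>lam mu al. lam \<noteq> 0 \<and> mu \<noteq> 0 \<and> al \<noteq> 0 \<and>
               lie_module_iso mscale act smult (Omega lam mu al)))"
proof (intro conjI iffI)
  show ex: "\<exists>lam mu al. lam \<noteq> 0 \<and> mu \<noteq> 0 \<and> lie_module_iso mscale act smult (Omega lam mu al)"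
    by (rule free_module_iso_Omega[OF assms])
  assume "simple_lie_module mscale act"
  \<comment> \<open>The parameters from \<open>ex\<close> serve: \<open>al = 0\<close> would carry
    simplicity over to \<open>Omega lam mu 0\<close>.\<close>
  with ex show "\<exists>lam mu al. lam \<noteq> 0 \<and> mu \<noteq> 0 \<and> al \<noteq> 0 \<and>
      lie_module_iso mscale act smult (Omega lam mu al)"
    using simple_lie_module_iso[OF lie_module_iso_sym] Omega_0_not_simple by metis
next
  assume "\<exists>lam mu al. lam \<noteq> 0 \<and> mu \<noteq> 0 \<and> al \<noteq> 0 \<and>
    lie_module_iso mscale act smult (Omega lam mu al)"
  then show "simple_lie_module mscale act"
    using simple_lie_module_iso Omega_simple by blast
qed

end
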